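(* Let $A \in \mathbb{R}^{n\times n}$ be a hidden $Z$-matrix with $v(A) > 0$. Then $A$ is a $P$-matrix.
   Context: All matrices are real, and vector inequalities are componentwise. A square matrix is a $Z$-matrix if all its off-diagonal entries are nonpositive. A matrix $A \in \mathbb{R}^{n\times n}$ is a hidden $Z$-matrix if there exist $Z$-matrices $X, Y \in \mathbb{R}^{n\times n}$ and vectors $r, s \in \mathbb{R}^n_+$ (nonnegative vectors) such that $AX = Y$ and $r^TX + s^TY > 0$. A square matrix is a $P$-matrix if all its principal minors are positive. For a matrix $A=(a_{ij}) \in \mathbb{R}^{n\times n}$, $v(A)$ denotes the (von Neumann) minimax value of the two-person zero-sum game with payoff matrix $A$, i.e. the number $v$ for which there are probability vectors $x^\star, y^\star$ with $\sum_i x^\star_i a_{ij} \le v$ for all $j$ and $\sum_j a_{ij} y^\star_j \ge v$ for all $i$. Thus $v(A) > 0$ if and only if there exists $0 \neq x \geq 0$ with $Ax > 0$. *)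

theory Defs
  imports "HOL-Analysis.Analysis"
begin

definition Z_matrix :: "real^'n^'n \<Rightarrow> bool" where
  "Z_matrix A \<longleftrightarrow> (\<forall>i j. i \<noteq> j \<longrightarrow> A $ i $ j \<le> 0)"

text \<open>The strict inequality is spelled out componentwise because \<open><\<close> on vectors in the
  library is not the componentwise strict order.\<close>

definition hidden_Z_matrix :: "real^'n^'n \<Rightarrow> bool" where
  "hidden_Z_matrix A \<longleftrightarrow>
     (\<exists>X Y :: real^'n^'n. \<exists>r s :: real^'n.
        Z_matrix X \<and> Z_matrix Y \<and> (\<forall>i. 0 \<le> r $ i) \<and> (\<forall>i. 0 \<le> s $ i) \<and>
        A ** X = Y \<and> (\<forall>j. 0 < (r v* X + s v* Y) $ j))"

text \<open>The determinant of the submatrix of \<open>A\<close> with rows and columns in \<open>S\<close>, by the Leibniz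
  formula that also defines \<^const>\<open>det\<close>; a submatrix indexed by a set of indices, rather than
  by a type, is not an object of the library. See \<open>principal_minor_UNIV\<close> and
  \<open>principal_minor_range\<close> for the agreement with \<^const>\<open>det\<close>.\<close>

definition principal_minor :: "real^'n^'n \<Rightarrow> 'n set \<Rightarrow> real" where
  "principal_minor A S = (\<Sum>p | p permutes S. of_int (sign p) * (\<Prod>i\<in>S. A $ i $ p i))"

definition P_matrix :: "real^'n^'n \<Rightarrow> bool" where
  "P_matrix A \<longleftrightarrow> (\<forall>S. S \<noteq> {} \<longrightarrow> 0 < principal_minor A S)"

definition probability_vector :: "real^'n \<Rightarrow> bool" where
  "probability_vector x \<longleftrightarrow> (\<forall>i. 0 \<le> x $ i) \<and> (\<Sum>i\<in>UNIV. x $ i) = 1"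

definition is_game_value :: "real^'n^'n \<Rightarrow> real \<Rightarrow> bool" where
  "is_game_value A v \<longleftrightarrow>
     (\<exists>x y. probability_vector x \<and> probability_vector y \<and>
        (\<forall>j. (\<Sum>i\<in>UNIV. x $ i * A $ i $ j) \<le> v) \<and>
        (\<forall>i. v \<le> (\<Sum>j\<in>UNIV. A $ i $ j * y $ j)))"

text \<open>Exactly one number satisfies the description: see \<open>ex1_game_value\<close>.\<close>

definition game_value :: "real^'n^'n \<Rightarrow> real" where
  "game_value A = (THE v. is_game_value A v)"

lemma principal_minor_UNIV: "principal_minor A UNIV = det A"
  by (simp add: principal_minor_def det_def)

lemma principal_minor_range:
  fixes A :: "real^'n^'n" and f :: "'m::finite \<Rightarrow> 'n"
  assumes f: "inj f"
  shows "principal_minor A (range f) = det (\<chi> i j. A $ f i $ f j)"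
proof -
  let ?F = "\<lambda>p. \<lambda>x. if x \<in> range f then f (p (inv f x)) else x"
  have inv[simp]: "inv f (f a) = a" for a
    using f by simp
  have bij: "bij_betw f UNIV (range f)"
    using f by (simp add: bij_betw_def)
  have bb: "bij_betw ?F {p. p permutes (UNIV::'m set)} {p. p permutes range f}"
    using bij_betw_permutations[OF bij] by simp
  have sgn: "sign (?F p) = sign p" if p: "p permutes (UNIV::'m set)" for p
  proof -
    have "map_permutation UNIV f p = ?F p"
      by (auto simp: map_permutation_def fun_eq_iff restrict_id_def)
    moreover have "sign (map_permutation UNIV f p) = sign p"
      using p f by (intro sign_map_permutation) auto
    ultimately show ?thesis by simp
  qed
  have "principal_minor A (range f) =
      (\<Sum>p | p permutes (UNIV::'m set). of_int (sign (?F p)) * (\<Prod>i\<in>range f. A $ i $ ?F p i))"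
    unfolding principal_minor_def by (rule sum.reindex_bij_betw[OF bb, symmetric])
  also have "\<dots> = (\<Sum>p | p permutes (UNIV::'m set). of_int (sign p) * (\<Prod>i\<in>UNIV. A $ f i $ f (p i)))"
  proof (rule sum.cong[OF refl])
    fix p assume "p \<in> {p. p permutes (UNIV::'m set)}"
    then have p: "p permutes (UNIV::'m set)" by simp
    have "(\<Prod>i\<in>range f. A $ i $ ?F p i) = (\<Prod>i\<in>UNIV. A $ f i $ ?F p (f i))"
      by (rule prod.reindex_bij_betw[OF bij, symmetric])
    then show "of_int (sign (?F p)) * (\<Prod>i\<in>range f. A $ i $ ?F p i) =
        of_int (sign p) * (\<Prod>i\<in>UNIV. A $ f i $ f (p i))"
      using sgn[OF p] by simp
  qed
  finally show ?thesis by (simp add: det_def)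
qed

lemma game_value_le:
  assumes "is_game_value A u" "is_game_value A v"
  shows "u \<le> v"
proof -
  obtain x where x: "probability_vector x" "\<And>j. (\<Sum>i\<in>UNIV. x $ i * A $ i $ j) \<le> v"
    using assms(2) unfolding is_game_value_def by blast
  obtain y where y: "probability_vector y" "\<And>i. u \<le> (\<Sum>j\<in>UNIV. A $ i $ j * y $ j)"
    using assms(1) unfolding is_game_value_def by blast
  have "u = (\<Sum>i\<in>UNIV. x $ i * u)"
    using x(1) by (simp add: probability_vector_def flip: sum_distrib_right)
  also have "\<dots> \<le> (\<Sum>i\<in>UNIV. x $ i * (\<Sum>j\<in>UNIV. A $ i $ j * y $ j))"
    using x(1) y(2) by (intro sum_mono mult_left_mono) (auto simp: probability_vector_def)
  also have "\<dots> = (\<Sum>j\<in>UNIV. (\<Sum>i\<in>UNIV. x $ i * A $ i $ j) * y $ j)"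
    unfolding sum_distrib_left sum_distrib_right
    by (subst sum.swap) (simp add: mult.assoc)
  also have "\<dots> \<le> (\<Sum>j\<in>UNIV. v * y $ j)"
    using y(1) x(2) by (intro sum_mono mult_right_mono) (auto simp: probability_vector_def)
  also have "\<dots> = v"
    using y(1) by (simp add: probability_vector_def flip: sum_distrib_left)
  finally show ?thesis .
qed

lemma probability_vector_axis: "probability_vector (axis j 1)"
  by (simp add: probability_vector_def axis_def)

lemma compact_probability_vectors: "compact {y :: real^'n. probability_vector y}"
proof -
  have "closed {y :: real^'n. probability_vector y}"
    unfolding probability_vector_def
    by (intro closed_Collect_conj closed_Collect_all closed_Collect_le closed_Collect_eq
        continuous_intros)
  moreover have "bounded {y :: real^'n. probability_vector y}"
  proof (rule boundedI)
    fix y :: "real^'n" assume "y \<in> {y. probability_vector y}"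
    then show "norm y \<le> 1"
      using norm_le_l1_cart[of y] by (simp add: probability_vector_def)
  qed
  ultimately show ?thesis by (simp add: compact_eq_bounded_closed)
qed

lemma convex_probability_vectors: "convex {y :: real^'n. probability_vector y}"
  by (auto simp: convex_def probability_vector_def sum.distrib simp flip: sum_distrib_left)

lemma ex_game_value:
  fixes A :: "real^'n^'n"
  shows "\<exists>v. is_game_value A v"
proof -
  let ?D = "{y :: real^'n. probability_vector y}"
  define f where "f y = Min (range (\<lambda>i. (A *v y) $ i))" for y
  have "continuous_on ?D f"
  proof -
    have "continuous_on ?D (\<lambda>y. Min ((\<lambda>i. (A *v y) $ i) ` I))" if "finite I" "I \<noteq> {}" for I
      using that
    proof (induction I rule: finite_ne_induct)
      case (singleton x)
      show ?case by (auto intro!: continuous_intros matrix_vector_mult_linear_continuous_on)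
    next
      case (insert x F)
      then show ?case
        by (auto intro!: continuous_intros matrix_vector_mult_linear_continuous_on)
    qed
    then show ?thesis unfolding f_def by simp
  qed
  moreover have "?D \<noteq> {}" using probability_vector_axis by blast
  ultimately obtain y where y: "y \<in> ?D" "\<And>z. z \<in> ?D \<Longrightarrow> f z \<le> f y"
    using continuous_attains_sup[OF compact_probability_vectors, of f] by blast
  define v where "v = f y"
  have vy: "v \<le> (A *v y) $ i" for i
    unfolding v_def f_def by (rule Min_le) auto
  let ?C = "(\<lambda>y. A *v y) ` ?D" and ?E = "{z :: real^'n. \<forall>i. v < z $ i}"
  have disj: "?C \<inter> ?E = {}"
  proof (rule ccontr)
    assume "?C \<inter> ?E \<noteq> {}"
    then obtain z where z: "z \<in> ?D" "\<And>i. v < (A *v z) $ i" by auto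
    have "f z \<in> range (\<lambda>i. (A *v z) $ i)" unfolding f_def by (rule Min_in) auto
    then have "v < f z" using z(2) by auto
    then show False using y(2)[OF z(1)] v_def by simp
  qed
  have "convex ?C"
    by (intro convex_linear_image matrix_vector_mul_linear convex_probability_vectors)
  moreover have "convex ?E"
  proof -
    have "?E = (\<Inter>i. {z. v < z $ i})" by auto
    moreover have "convex {z :: real^'n. v < z $ i}" for i
      using convex_halfspace_gt[of v "axis i 1 :: real^'n"] by (simp add: inner_axis')
    ultimately show ?thesis by (auto intro: convex_INT)
  qed
  moreover have E: "(\<chi> i. w i) \<in> ?E" if "\<And>i. v < w i" for w using that by simp
  moreover have "?E \<noteq> {}" using E[of "\<lambda>_. v + 1"] by (metis empty_iff less_add_one)
  moreover have "?C \<noteq> {}" using y(1) by blast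
  ultimately obtain a b where ab: "a \<noteq> 0" "\<And>x. x \<in> ?C \<Longrightarrow> a \<bullet> x \<le> b" "\<And>x. x \<in> ?E \<Longrightarrow> b \<le> a \<bullet> x"
    using separating_hyperplane_sets[OF _ _ _ _ disj] by blast
  have a0: "0 \<le> a $ k" for k
  proof (rule ccontr)
    assume "\<not> 0 \<le> a $ k"
    then have neg: "a $ k < 0" by simp
    define c where "c = (\<Sum>i\<in>UNIV. a $ i * (v + 1))"
    define t where "t = (\<bar>c - b\<bar> + 1) / (- a $ k)"
    have "t > 0" using neg unfolding t_def by (intro divide_pos_pos) auto
    have "b \<le> a \<bullet> (\<chi> i. (v + 1) + (if i = k then t else 0))"
      using \<open>t > 0\<close> by (intro ab(3) E) auto
    also have "\<dots> = (\<Sum>i\<in>UNIV. a $ i * (v + 1) + (if i = k then a $ k * t else 0))"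
      unfolding inner_vec_def by (intro sum.cong) (auto simp: algebra_simps)
    also have "\<dots> = c + a $ k * t"
      by (subst sum.distrib) (simp add: c_def)
    also have "a $ k * t = - (\<bar>c - b\<bar> + 1)" using neg by (simp add: t_def)
    finally show False by linarith
  qed
  define \<sigma> where "\<sigma> = (\<Sum>i\<in>UNIV. a $ i)"
  have "\<sigma> \<ge> 0" unfolding \<sigma>_def by (intro sum_nonneg) (simp add: a0)
  moreover have "\<sigma> \<noteq> 0"
    using ab(1) a0 unfolding \<sigma>_def by (simp add: sum_nonneg_eq_0_iff vec_eq_iff)
  ultimately have \<sigma>: "\<sigma> > 0" by simp
  have "b \<le> v * \<sigma>"
  proof (rule field_le_epsilon)
    fix e :: real assume "e > 0"
    then have "b \<le> a \<bullet> (\<chi> i. v + e / \<sigma>)" using \<sigma> by (intro ab(3) E) simp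
    also have "\<dots> = (v + e / \<sigma>) * \<sigma>"
      by (simp add: inner_vec_def \<sigma>_def mult.commute flip: sum_distrib_right)
    also have "\<dots> = v * \<sigma> + e" using \<sigma> by (simp add: distrib_right)
    finally show "b \<le> v * \<sigma> + e" .
  qed
  have "(\<Sum>i\<in>UNIV. ((1 / \<sigma>) *\<^sub>R a) $ i * A $ i $ j) \<le> v" for j
  proof -
    have "a \<bullet> (A *v axis j 1) \<le> b"
      using probability_vector_axis by (intro ab(2)) blast
    then have "(\<Sum>i\<in>UNIV. a $ i * A $ i $ j) \<le> v * \<sigma>"
      using \<open>b \<le> v * \<sigma>\<close> by (simp add: matrix_vector_mult_basis column_def inner_vec_def)
    then show ?thesis
      using \<sigma> by (simp add: divide_le_eq flip: sum_divide_distrib)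
  qed
  moreover have "probability_vector ((1 / \<sigma>) *\<^sub>R a)"
    using \<sigma> a0 by (simp add: probability_vector_def \<sigma>_def flip: sum_divide_distrib)
  ultimately have "is_game_value A v"
    using y(1) vy unfolding is_game_value_def matrix_vector_mult_def
    by (intro exI[of _ "(1 / \<sigma>) *\<^sub>R a"] exI[of _ y]) auto
  then show ?thesis ..
qed

lemma ex1_game_value: "\<exists>!v. is_game_value A v"
  using ex_game_value game_value_le by (metis order_antisym)

end

theory Submission
  imports Defs
begin

text \<open>Let \<open>A X = Y\<close> with \<open>r\<^sup>T X + s\<^sup>T Y > 0\<close>. The \<open>Z\<close>-matrix \<open>diag(r) X + diag(s) Y\<close> has positive
  column sums, hence is inverse nonnegative, and so \<open>X\<close> is nonsingular. Choose \<open>p > 0\<close> with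
  \<open>A p > 0\<close> and put \<open>u = X\<^sup>-\<^sup>1 p\<close>; then \<open>(diag(r) X + diag(s) Y) u = diag(r) p + diag(s) A p \<ge> 0\<close>
  gives \<open>u \<ge> 0\<close>. Let \<open>W\<close> take its rows in \<open>S\<close> from \<open>Y\<close> and the others from \<open>X\<close>: it is a
  \<open>Z\<close>-matrix with \<open>W u > 0\<close>, so \<open>det W > 0\<close>. Since \<open>W\<close> is the product with \<open>X\<close> of the matrix
  that takes its rows in \<open>S\<close> from \<open>A\<close> and the others from the identity, \<open>det W\<close> is the principal
  minor at \<open>S\<close> times \<open>det X\<close>, and \<open>det X > 0\<close> is the case \<open>S = {}\<close>.\<close>

lemma Z_matrix_transpose: "Z_matrix (transpose M) \<longleftrightarrow> Z_matrix M"
  by (auto simp: Z_matrix_def transpose_def)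

text \<open>If the set \<open>N\<close> of indices with \<open>x $ i < 0\<close> were nonempty, the
  sum of the rows of \<open>M *v x\<close> in \<open>N\<close>, weighted by \<open>w\<close>, would
  be negative. The coefficient \<open>c j\<close> of \<open>x $ j\<close> in it is a sum of
  nonpositive terms for \<open>j\<close> outside \<open>N\<close>; for \<open>j\<close> in
  \<open>N\<close> it is positive, because the rows left out contribute only nonpositive terms to
  the positive number \<open>(w v* M) $ j\<close>.\<close>

lemma Z_matrix_nonneg_of_mult_nonneg:
  fixes M :: "real^'n^'n"
  assumes Z: "Z_matrix M" and w: "\<And>i. 0 \<le> w $ i" and wM: "\<And>j. 0 < (w v* M) $ j"
    and x: "\<And>i. 0 \<le> (M *v x) $ i"
  shows "0 \<le> x $ k"
proof (rule ccontr)
  assume k: "\<not> 0 \<le> x $ k"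
  define N where "N = {i. x $ i < 0}"
  define c where "c j = (\<Sum>i\<in>N. w $ i * M $ i $ j)" for j
  have neg: "c j * x $ j < 0" if "j \<in> N" for j
  proof -
    have "w $ i * M $ i $ j \<le> 0" if "i \<in> - N" for i
    proof -
      have "i \<noteq> j" using that \<open>j \<in> N\<close> by auto
      then show ?thesis using w Z by (simp add: Z_matrix_def mult_nonneg_nonpos)
    qed
    then have "(\<Sum>i\<in>-N. w $ i * M $ i $ j) \<le> 0"
      by (rule sum_nonpos)
    moreover have "(w v* M) $ j = c j + (\<Sum>i\<in>-N. w $ i * M $ i $ j)"
      unfolding c_def vector_matrix_mult_def
      using sum.subset_diff[of N UNIV "\<lambda>i. w $ i * M $ i $ j"]
      by (simp add: Compl_eq_Diff_UNIV add.commute)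
    ultimately have "0 < c j" using wM[of j] by linarith
    then show ?thesis using that by (simp add: N_def mult_pos_neg)
  qed
  have nonpos: "c j * x $ j \<le> 0" if "j \<notin> N" for j
  proof -
    have "w $ i * M $ i $ j \<le> 0" if "i \<in> N" for i
    proof -
      have "i \<noteq> j" using that \<open>j \<notin> N\<close> by auto
      then show ?thesis using w Z by (simp add: Z_matrix_def mult_nonneg_nonpos)
    qed
    then have "c j \<le> 0" unfolding c_def by (rule sum_nonpos)
    then show ?thesis using that by (simp add: N_def mult_nonpos_nonneg)
  qed
  have "0 \<le> (\<Sum>i\<in>N. w $ i * (M *v x) $ i)"
    using w x by (intro sum_nonneg) simp
  also have "\<dots> = (\<Sum>j\<in>UNIV. c j * x $ j)"
    unfolding c_def matrix_vector_mult_def vec_lambda_beta sum_distrib_left sum_distrib_right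
    by (subst sum.swap) (simp only: mult.assoc)
  also have "\<dots> < (\<Sum>j\<in>(UNIV :: 'n set). 0)"
  proof (rule sum_strict_mono_ex1)
    show "\<forall>j\<in>UNIV. c j * x $ j \<le> 0" using neg nonpos by (meson less_imp_le)
    show "\<exists>j\<in>UNIV. c j * x $ j < 0" using neg[of k] k by (auto simp: N_def)
  qed simp
  finally show False by simp
qed

lemma Z_matrix_mult_eq_0:
  fixes M :: "real^'n^'n"
  assumes "Z_matrix M" "\<And>i. 0 \<le> w $ i" "\<And>j. 0 < (w v* M) $ j" and x: "M *v x = 0"
  shows "x = 0"
proof -
  have "M *v (- x) = 0" using x linear_neg[OF matrix_vector_mul_linear, of M x] by simp
  then have "0 \<le> x $ k \<and> 0 \<le> (- x) $ k" for k
    using x Z_matrix_nonneg_of_mult_nonneg[OF assms(1-3), of x k]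
      Z_matrix_nonneg_of_mult_nonneg[OF assms(1-3), of "- x" k] by simp
  then show ?thesis by (auto simp: vec_eq_iff intro!: order_antisym)
qed

lemma det_neq_0_iff_mult_eq_0:
  fixes M :: "real^'n^'n"
  shows "det M \<noteq> 0 \<longleftrightarrow> (\<forall>x. M *v x = 0 \<longrightarrow> x = 0)"
  by (simp add: invertible_det_nz[symmetric] invertible_left_inverse matrix_left_invertible_ker)

text \<open>The determinant does not vanish on the segment from the identity to \<open>M\<close>.\<close>

lemma Z_matrix_det_pos:
  fixes M :: "real^'n^'n"
  assumes Z: "Z_matrix M" and w: "\<And>i. 0 \<le> w $ i" and wM: "\<And>j. 0 < (w v* M) $ j"
  shows "0 < det M"
proof (rule ccontr)
  define B where "B t = t *\<^sub>R M + (1 - t) *\<^sub>R (mat 1 :: real^'n^'n)" for t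
  assume "\<not> 0 < det M"
  then have "det (B 1) \<le> 0" "0 \<le> det (B 0)" by (simp_all add: B_def)
  moreover have "continuous_on {0..1} (\<lambda>t. det (B t))"
    unfolding det_def B_def by (auto intro!: continuous_intros)
  ultimately obtain t where t: "0 \<le> t" "t \<le> 1" "det (B t) = 0"
    using IVT2'[of "\<lambda>t. det (B t)" 1 0 0] by auto
  \<comment> \<open>Since \<open>w\<close> may have zero entries, the identity part alone need not
    make \<open>w v* B t\<close> positive; a positive weight on \<open>M\<close> does.\<close>
  have "t \<noteq> 0" using t(3) by (auto simp: B_def)
  with t have "0 < t" by simp
  have "(w v* B t) $ j = t * (w v* M) $ j + (1 - t) * w $ j" for j
  proof -
    have "(w v* B t) $ j =
        (\<Sum>i\<in>UNIV. t * (M $ i $ j * w $ i) + (if i = j then (1 - t) * w $ i else 0))"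
      unfolding vector_matrix_mult_def B_def mat_def
      by (simp add: algebra_simps) (intro sum.cong; simp add: algebra_simps)
    then show ?thesis
      by (simp add: vector_matrix_mult_def sum.distrib sum_distrib_left mult.commute)
  qed
  then have "0 < (w v* B t) $ j" for j
    using \<open>0 < t\<close> t(2) w[of j] wM[of j] by (simp add: add_pos_nonneg)
  moreover have "Z_matrix (B t)"
    using Z t by (auto simp: Z_matrix_def B_def mat_def mult_nonneg_nonpos)
  ultimately have "det (B t) \<noteq> 0"
    using Z_matrix_mult_eq_0[OF _ w] det_neq_0_iff_mult_eq_0 by blast
  with t(3) show False by simp
qed

lemma Z_matrix_det_pos_of_mult_pos:
  fixes M :: "real^'n^'n"
  assumes "Z_matrix M" "\<And>i. 0 \<le> u $ i" "\<And>j. 0 < (M *v u) $ j"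
  shows "0 < det M"
  using Z_matrix_det_pos[of "transpose M" u] assms by (simp add: Z_matrix_transpose)

text \<open>A permutation that moves an index outside \<open>S\<close> picks an off-diagonal zero
  from a row of the identity, so its Leibniz term vanishes. The remaining ones permute
  \<open>S\<close> and pick ones outside it. In this form minors are accessible to the product rule
  for determinants.\<close>

lemma principal_minor_eq_det:
  fixes A :: "real^'n^'n"
  shows "principal_minor A S = det (\<chi> i. if i \<in> S then A $ i else mat 1 $ i)"
proof -
  let ?B = "(\<chi> i. if i \<in> S then A $ i else mat 1 $ i) :: real^'n^'n"
  let ?f = "\<lambda>p. of_int (sign p) * (\<Prod>i\<in>UNIV. ?B $ i $ p i)"
  have "det ?B = sum ?f {p. p permutes S}"
    unfolding det_def
  proof (rule sum.mono_neutral_right)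
    show "\<forall>p\<in>{p. p permutes UNIV} - {p. p permutes S}. ?f p = 0"
    proof
      fix p assume p: "p \<in> {p. p permutes (UNIV :: 'n set)} - {p. p permutes S}"
      then obtain i where "i \<notin> S" "p i \<noteq> i"
        unfolding permutes_def by blast
      then have "?B $ i $ p i = 0" by (simp add: mat_def)
      then have "(\<Prod>i\<in>UNIV. ?B $ i $ p i) = 0" by (intro prod_zero bexI[of _ i]) simp_all
      then show "?f p = 0" by simp
    qed
  qed (auto intro: permutes_subset)
  also have "\<dots> = principal_minor A S"
    unfolding principal_minor_def
  proof (rule sum.cong[OF refl])
    fix p assume "p \<in> {p. p permutes S}"
    then have "?B $ i $ p i = 1" if "i \<notin> S" for i
      using that permutes_not_in[of p S i] by (simp add: mat_def)
    then have "(\<Prod>i\<in>UNIV. ?B $ i $ p i) = (\<Prod>i\<in>S. A $ i $ p i)"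
      by (intro prod.mono_neutral_cong_right) simp_all
    then show "?f p = of_int (sign p) * (\<Prod>i\<in>S. A $ i $ p i)" by simp
  qed
  finally show ?thesis ..
qed

text \<open>An optimal column strategy \<open>y\<close> has a positive image under \<open>A\<close>
  but may have zero entries. A small positive multiple of the all-ones vector makes every entry
  positive and, by continuity, keeps the image positive.\<close>

lemma game_value_pos_obtains:
  fixes A :: "real^'n^'n"
  assumes "0 < game_value A"
  obtains p where "\<And>i. 0 < p $ i" "\<And>i. 0 < (A *v p) $ i"
proof -
  have "is_game_value A (game_value A)"
    unfolding game_value_def by (rule theI'[OF ex1_game_value])
  then obtain y where y: "probability_vector y" "\<And>i. game_value A \<le> (A *v y) $ i"
    unfolding is_game_value_def matrix_vector_mult_def by auto
  let ?p = "\<lambda>e :: real. y + e *\<^sub>R 1"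
  have "\<forall>\<^sub>F e in at_right 0. 0 < (A *v ?p e) $ i" for i
  proof (rule order_tendstoD(1))
    have "((\<lambda>e. (A *v y) $ i + e * (A *v 1) $ i) \<longlongrightarrow> (A *v y) $ i + 0 * (A *v 1) $ i) (at_right 0)"
      by (intro tendsto_intros)
    then show "((\<lambda>e. (A *v ?p e) $ i) \<longlongrightarrow> (A *v y) $ i) (at_right 0)"
      by (simp add: matrix_vector_right_distrib scaleR_matrix_vector_assoc[symmetric]
          matrix_vector_mult_scaleR)
    show "0 < (A *v y) $ i" using y(2)[of i] assms by linarith
  qed
  then have "\<forall>\<^sub>F e in at_right 0. \<forall>i. 0 < (A *v ?p e) $ i"
    by (rule eventually_all_finite)
  then have "\<forall>\<^sub>F e in at_right 0. 0 < e \<and> (\<forall>i. 0 < (A *v ?p e) $ i)"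
    using eventually_at_right_less by eventually_elim simp
  then obtain e where "0 < e" "\<And>i. 0 < (A *v ?p e) $ i"
    using eventually_happens'[OF trivial_limit_at_right_real] by blast
  moreover have "0 < ?p e $ i" for i
    using y(1) \<open>0 < e\<close> by (simp add: probability_vector_def add_nonneg_pos)
  ultimately show ?thesis using that by blast
qed

theorem theorem3p4:
  fixes A :: "real^'n^'n"
  assumes "hidden_Z_matrix A" and "game_value A > 0"
  shows "P_matrix A"
proof -
  obtain X Y :: "real^'n^'n" and r s :: "real^'n" where
    Z: "Z_matrix X" "Z_matrix Y" and r: "\<And>i. 0 \<le> r $ i" and s: "\<And>i. 0 \<le> s $ i"
    and AX: "A ** X = Y" and rs: "\<And>j. 0 < (r v* X + s v* Y) $ j"
    using assms(1) unfolding hidden_Z_matrix_def by blast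
  obtain p where p: "\<And>i. 0 < p $ i" "\<And>i. 0 < (A *v p) $ i"
    using game_value_pos_obtains[OF assms(2)] by blast
  have Y: "Y *v x = A *v (X *v x)" for x
    by (simp add: AX[symmetric] matrix_vector_mul_assoc)
  define M :: "real^'n^'n" where "M = (\<chi> i. r $ i *\<^sub>R X $ i + s $ i *\<^sub>R Y $ i)"
  have "Z_matrix M"
    using Z r s by (auto simp: Z_matrix_def M_def intro!: add_nonpos_nonpos mult_nonneg_nonpos)
  moreover have "1 v* M = r v* X + s v* Y"
    by (simp add: vec_eq_iff vector_matrix_mult_def M_def sum.distrib mult.commute)
  ultimately have M: "Z_matrix M" "\<And>i. 0 \<le> (1 :: real^'n) $ i" "\<And>j. 0 < (1 v* M) $ j"
    using rs by simp_all
  have Mx: "(M *v x) $ i = r $ i * (X *v x) $ i + s $ i * (Y *v x) $ i" for x i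
    by (simp add: matrix_vector_mult_def M_def algebra_simps sum.distrib sum_distrib_left)
  \<comment> \<open>The kernel of \<open>X\<close> lies in that of \<open>Y\<close>, as
    \<open>Y\<close> is \<open>A ** X\<close>, and hence in that of \<open>M\<close>.\<close>
  have "x = 0" if "X *v x = 0" for x
  proof (rule Z_matrix_mult_eq_0[OF M])
    show "M *v x = 0" by (simp add: vec_eq_iff Mx Y that)
  qed
  then have "invertible X"
    using det_neq_0_iff_mult_eq_0 invertible_det_nz by blast
  then obtain X' where "X ** X' = mat 1"
    unfolding invertible_def by blast
  then have Xu: "X *v (X' *v p) = p"
    by (simp add: matrix_vector_mul_assoc)
  define u where "u = X' *v p"
  have u: "X *v u = p" "Y *v u = A *v p" using Xu by (simp_all add: u_def Y)
  have u0: "0 \<le> u $ i" for i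
    using Z_matrix_nonneg_of_mult_nonneg[OF M, of u i] r s p
    by (simp add: Mx u less_imp_le)
  have pos: "0 < principal_minor A S * det X" for S
  proof -
    let ?B = "(\<chi> i. if i \<in> S then A $ i else mat 1 $ i) :: real^'n^'n"
    have row: "(?B ** X) $ i = (if i \<in> S then Y $ i else X $ i)" for i
    proof (cases "i \<in> S")
      case False
      then have "(?B ** X) $ i = (mat 1 ** X) $ i"
        unfolding matrix_matrix_mult_def by simp
      with False show ?thesis by simp
    qed (simp add: matrix_matrix_mult_def flip: AX)
    \<comment> \<open>The sign condition concerns each row separately, so it survives mixing rows of
      \<open>X\<close> and \<open>Y\<close>.\<close>
    have "Z_matrix (?B ** X)"
      using Z unfolding Z_matrix_def row by simp
    \<comment> \<open>Rows in \<open>S\<close> yield entries of \<open>A *v p\<close>, the others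
      entries of \<open>p\<close>; this is why \<open>p\<close> was chosen strictly
      positive.\<close>
    moreover have "0 < ((?B ** X) *v u) $ i" for i
    proof -
      have "((?B ** X) *v u) $ i = (if i \<in> S then (Y *v u) $ i else (X *v u) $ i)"
        unfolding matrix_vector_mult_def by (simp add: row)
      then show ?thesis using p by (simp add: u)
    qed
    ultimately have "0 < det (?B ** X)"
      using Z_matrix_det_pos_of_mult_pos u0 by blast
    then show ?thesis by (simp add: det_mul principal_minor_eq_det)
  qed
  \<comment> \<open>The empty minor is 1: the identity is the only permutation of the empty set, and
    its product is empty.\<close>
  have "0 < det X"
    using pos[of "{}"] by (simp add: principal_minor_def)
  then show ?thesis
    using pos by (auto simp: P_matrix_def zero_less_mult_iff)
qed

end
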